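(* Let $N\ge3$ be odd and $\lambda_1,\dots,\lambda_N$ real parameters. Let $M^{2N}=\mathcal{O}(\lambda_1)\times\mathcal{O}(\lambda_2)\times\dots\times\mathcal{O}(\lambda_N)$ be the product of symplectic leaves and consider its Hamiltonian reduction, i.e. the quotient $M^{2N}/T^N$ by the Hamiltonian action of $T^N\cong\mathbf{R}^N$ $$L(\zeta,\lambda_i)\mapsto \hat t_i\,L(\zeta,\lambda_i)\,\hat t_{i+1}^{-1},\qquad i=1,\dots,N \ (\text{indices mod } N),$$ with the Poisson bracket induced on invariant functions. Then the phase space of the periodic dressing chain with period $N$ (with its Poisson structure) is this Hamiltonian reduction: identifying $M^{2N}/T^N$ with $\mathbf{R}^N$ via $(f_1,\dots,f_N)\mapsto$ the class of $(\mathcal{L}(f_1,\lambda_1),\dots,\mathcal{L}(f_N,\lambda_N))$, the reduced Poisson structure is the Poisson structure of the periodic dressing chain. Moreover, the reduced transfer maps, i.e. the maps induced on $M^{2N}/T^N$ by the transfer correspondences $T_i^{(N)}$ of the re-factorisation correspondence on the leaves, coincide under this identification with Adler's dynamical systems, i.e. (as rational maps) with the transfer-maps $T_i^{(N)}$, $i=1,\dots,N$, of the Adler map.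
   Context: Leaves. $\mathcal{O}(\lambda)$ is the symplectic leaf in the loop group $LGL(2,\mathbf{R})$ (with the Sklyanin Poisson structure) consisting of the matrices $$L(\zeta,\lambda)=\begin{pmatrix} a & ad+\lambda-\zeta\\ 1& d\end{pmatrix},\qquad a,d\in\mathbf{R},$$ where the symplectic structure is given by $\{a,d\}=1$. On the product $M^{2N}$, with coordinates $a_i,d_i$ on the $i$-th factor, $\{a_i,d_i\}=1$ and brackets between different factors vanish. Action. $\hat t=\begin{pmatrix}1&t\\0&1\end{pmatrix}$, $t\in\mathbf{R}$. The action of $t_i$ is $a_i\mapsto a_i+t_i$, $d_{i-1}\mapsto d_{i-1}-t_i$, other variables unchanged, and it is generated by the Hamiltonian $H_i=a_{i-1}+d_i$. "Hamiltonian reduction" here means the quotient of $M^{2N}$ by this action, with the Poisson bracket on functions on the quotient being the bracket of the corresponding invariant functions on $M^{2N}$. Also $$\mathcal{L}(f,\lambda)=\begin{pmatrix} f& f^2+\lambda-\zeta\\ 1& f\end{pmatrix}.$$ Dressing chain. The periodic dressing chain is the system $(f_i+f_{i+1})'=f_i^2-f_{i+1}^2+\lambda_i-\lambda_{i+1}$, $i=1,\dots,N$, with $f_{N+1}=f_1$, $\lambda_{N+1}=\lambda_1$. For odd $N$ its phase space is $\mathbf{R}^N$ with coordinates $f_1,\dots,f_N$ and the Poisson structure determined, in the coordinates $g_i=f_i+f_{i+1}$ (indices mod $N$), by $\{g_i,g_{i+1}\}=1=-\{g_{i+1},g_i\}$, all other brackets of the $g$'s being zero. Transfer maps. For a (possibly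 multivalued) parameter-dependent map $R(\lambda,\mu)$ of $X\times X$ into itself, $R_{ij}=R_{ij}(\lambda_i,\lambda_j)$ acts on $X^N$ as $R(\lambda_i,\lambda_j)$ on the $i$-th and $j$-th factors (in this order) and identically on the others, and $$T_i^{(N)}=R_{i\,i+N-1}R_{i\,i+N-2}\cdots R_{i\,i+1}\quad(\text{indices mod }N,\ \text{rightmost applied first}).$$ On the leaves, $X=\mathbf{R}^2$ with coordinates $(a,d)$ and $R(\lambda,\mu)$ is the multivalued correspondence $(L,L')\mapsto(\tilde L,\tilde L')$, with $L,\tilde L\in\mathcal{O}(\lambda)$, $L',\tilde L'\in\mathcal{O}(\mu)$, defined by the re-factorisation relation $L\,L'=\tilde L'\,\tilde L$ for all $\zeta$. The Adler map is the Yang-Baxter map on $X=\mathbf{R}$ given by $R(\lambda,\mu):(x,y)\mapsto(\tilde x,\tilde y)$, $$\tilde x=y-\frac{\lambda-\mu}{x+y},\qquad \tilde y=x-\frac{\mu-\lambda}{x+y}.$$ *)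

theory Defs
  imports "HOL-Analysis.Analysis" "HOL-Library.Numeral_Type"
begin

text \<open>
  The index type \<open>'n\<close> plays the role of the integers modulo \<open>N = CARD('n)\<close>: it is a finite
  commutative ring, and the condition \<open>surj (of_nat :: nat \<Rightarrow> 'n)\<close>, imposed wherever it matters,
  says that \<open>1\<close> generates it additively. So \<open>i + 1\<close> is the cyclic successor of \<open>i\<close>; the
  index \<open>0\<close> plays the role of \<open>N\<close>. Every odd \<open>N \<ge> 3\<close> occurs, for the types \<open>'m bit1\<close>
  (see \<open>surj_of_nat_bit1\<close>).
\<close>

lemma surj_of_nat_bit1: "surj (of_nat :: nat \<Rightarrow> 'm::finite bit1)"
proof (rule surjI)
  fix x :: "'m bit1"
  obtain z where "x = of_int z" "0 \<le> z"
    by (cases x rule: bit1_cases) auto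
  then show "of_nat (nat (SOME z. x = of_int z \<and> 0 \<le> z)) = x"
    using someI[of "\<lambda>z. x = of_int z \<and> 0 \<le> z" z] by simp
qed

section \<open>Smooth functions and partial derivatives\<close>

primrec C_k :: "nat \<Rightarrow> ('a::real_normed_vector \<Rightarrow> 'b::real_normed_vector) \<Rightarrow> bool" where
  "C_k 0 F \<longleftrightarrow> continuous_on UNIV F"
| "C_k (Suc k) F \<longleftrightarrow> (\<forall>x. F differentiable (at x)) \<and>
     (\<forall>v. C_k k (\<lambda>x. frechet_derivative F (at x) v))"

definition smooth :: "('a::real_normed_vector \<Rightarrow> 'b::real_normed_vector) \<Rightarrow> bool" where
  "smooth F \<longleftrightarrow> (\<forall>k. C_k k F)"

abbreviation dir_deriv :: "'a::real_normed_vector \<Rightarrow> ('a \<Rightarrow> real) \<Rightarrow> 'a \<Rightarrow> real" where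
  "dir_deriv v F x \<equiv> frechet_derivative F (at x) v"

section \<open>The leaves and their product\<close>

text \<open>
  A leaf is parametrised by its global coordinates \<open>(a, d)\<close>, so the product of the leaves is
  \<open>(real \<times> real) ^ 'n\<close>, and \<open>lax l (a, d)\<close> is the element of the leaf with parameter \<open>l\<close>
  that has these coordinates, a matrix function of the spectral parameter \<open>z\<close>.
\<close>

type_synonym 'n rvec = "(real, 'n) vec"
type_synonym 'n phase = "(real \<times> real, 'n) vec"

definition lax :: "real \<Rightarrow> real \<times> real \<Rightarrow> real \<Rightarrow> real ^ 2 ^ 2" where
  "lax l x z = vector [vector [fst x, fst x * snd x + l - z], vector [1, snd x]]"

definition leaf_bracket ::
  "('n phase \<Rightarrow> real) \<Rightarrow> ('n phase \<Rightarrow> real) \<Rightarrow> 'n::finite phase \<Rightarrow> real" where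
  "leaf_bracket F G x =
     (\<Sum>i\<in>UNIV. dir_deriv (axis i (1, 0)) F x * dir_deriv (axis i (0, 1)) G x
              - dir_deriv (axis i (0, 1)) F x * dir_deriv (axis i (1, 0)) G x)"

section \<open>The Hamiltonian action and the reduction\<close>

definition t_hat :: "real \<Rightarrow> real ^ 2 ^ 2" where
  "t_hat t = vector [vector [1, t], vector [0, 1]]"

definition leaf_gauge ::
  "'n rvec \<Rightarrow> 'n rvec \<Rightarrow> 'n phase \<Rightarrow> 'n::{finite,comm_ring_1} phase \<Rightarrow> bool"
  where
  "leaf_gauge lam t x y \<longleftrightarrow> (\<forall>i z. lax (lam $ i) (y $ i) z =
      t_hat (t $ i) ** lax (lam $ i) (x $ i) z ** matrix_inv (t_hat (t $ (i + 1))))"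

definition act ::
  "'n rvec \<Rightarrow> 'n phase \<Rightarrow> 'n::{finite,comm_ring_1} phase" where
  "act t x = (\<chi> i. (fst (x $ i) + t $ i, snd (x $ i) - t $ (i + 1)))"

definition ham :: "'n \<Rightarrow> 'n::{finite,comm_ring_1} phase \<Rightarrow> real" where
  "ham i x = fst (x $ (i - 1)) + snd (x $ i)"

definition orbit_rel :: "'n rvec \<Rightarrow> ('n::{finite,comm_ring_1} phase \<times> 'n phase) set" where
  "orbit_rel lam = {(x, y). \<exists>t. leaf_gauge lam t x y}"

definition proj ::
  "'n rvec \<Rightarrow> 'n phase \<Rightarrow> 'n::{finite,comm_ring_1} phase set" where
  "proj lam x = orbit_rel lam `` {x}"

definition reduced_space :: "'n rvec \<Rightarrow> 'n::{finite,comm_ring_1} phase set set" where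
  "reduced_space lam = UNIV // orbit_rel lam"

text \<open>
  Functions on the reduced space are functions of orbits; \<open>\<phi> \<circ> proj lam\<close> is the invariant
  function corresponding to \<open>\<phi>\<close>.
\<close>

definition reduced_bracket ::
  "'n rvec \<Rightarrow> ('n phase set \<Rightarrow> real) \<Rightarrow> ('n phase set \<Rightarrow> real) \<Rightarrow>
    'n::{finite,comm_ring_1} phase set \<Rightarrow> real" where
  "reduced_bracket lam \<phi> \<psi> c =
     (THE r. \<forall>x\<in>c. leaf_bracket (\<phi> \<circ> proj lam) (\<psi> \<circ> proj lam) x = r)"

definition reduced_rel ::
  "'n rvec \<Rightarrow> ('n phase \<times> 'n phase) set \<Rightarrow>
    ('n::{finite,comm_ring_1} phase set \<times> 'n phase set) set" where
  "reduced_rel lam T = {(proj lam x, proj lam y) | x y. (x, y) \<in> T}"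

section \<open>The phase space of the dressing chain\<close>

definition chain_g :: "'n rvec \<Rightarrow> 'n::{finite,comm_ring_1} rvec" where
  "chain_g f = (\<chi> i. f $ i + f $ (i + 1))"

text \<open>
  The bracket is computed in the coordinates \<open>g = chain_g f\<close>, which are global linear
  coordinates when \<open>N\<close> is odd (see \<open>bij_chain_g\<close>); \<open>F \<circ> inv chain_g\<close> is \<open>F\<close> as a function of \<open>g\<close>.
\<close>

definition chain_bracket ::
  "('n rvec \<Rightarrow> real) \<Rightarrow> ('n rvec \<Rightarrow> real) \<Rightarrow> 'n::{finite,comm_ring_1} rvec \<Rightarrow> real" where
  "chain_bracket F G f =
     (\<Sum>i\<in>UNIV.
        dir_deriv (axis i 1) (F \<circ> inv chain_g) (chain_g f)
          * dir_deriv (axis (i + 1) 1) (G \<circ> inv chain_g) (chain_g f)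
      - dir_deriv (axis (i + 1) 1) (F \<circ> inv chain_g) (chain_g f)
          * dir_deriv (axis i 1) (G \<circ> inv chain_g) (chain_g f))"

text \<open>
  The matrix with entries \<open>f, f\<^sup>2 + l - z, 1, f\<close> is \<open>lax l (f, f) z\<close>.
\<close>

definition chain_class ::
  "'n rvec \<Rightarrow> 'n rvec \<Rightarrow> 'n::{finite,comm_ring_1} phase set" where
  "chain_class lam f = proj lam (\<chi> i. (f $ i, f $ i))"

section \<open>Transfer maps\<close>

text \<open>
  Multivalued and partially defined maps are relations. \<open>R l m (x, y) (x', y')\<close> means that
  \<open>(x', y')\<close> is one of the values of \<open>R(l, m)\<close> at \<open>(x, y)\<close>.
\<close>

type_synonym 'x yb_map = "real \<Rightarrow> real \<Rightarrow> 'x \<times> 'x \<Rightarrow> 'x \<times> 'x \<Rightarrow> bool"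

definition yb_at ::
  "'x yb_map \<Rightarrow> 'n rvec \<Rightarrow> 'n \<Rightarrow> 'n \<Rightarrow> (('x, 'n) vec \<times> ('x, 'n::finite) vec) set" where
  "yb_at R lam i j = {(x, y). R (lam $ i) (lam $ j) (x $ i, x $ j) (y $ i, y $ j) \<and>
     (\<forall>k. k \<noteq> i \<longrightarrow> k \<noteq> j \<longrightarrow> y $ k = x $ k)}"

text \<open>In \<open>r O s\<close> the relation \<open>r\<close> is applied first, so \<open>R\<^sub>i\<^sub>,\<^sub>i\<^sub>+\<^sub>1\<close> acts first.\<close>

primrec transfer_upto ::
  "'x yb_map \<Rightarrow> 'n rvec \<Rightarrow> 'n \<Rightarrow> nat \<Rightarrow> (('x, 'n) vec \<times> ('x, 'n::{finite,comm_ring_1}) vec) set" where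
  "transfer_upto R lam i 0 = Id"
| "transfer_upto R lam i (Suc k) =
     transfer_upto R lam i k O yb_at R lam i (i + of_nat (Suc k))"

definition transfer ::
  "'x yb_map \<Rightarrow> 'n rvec \<Rightarrow> 'n \<Rightarrow> (('x, 'n) vec \<times> ('x, 'n::{finite,comm_ring_1}) vec) set" where
  "transfer R lam i = transfer_upto R lam i (CARD('n) - 1)"

definition refactor :: "(real \<times> real) yb_map" where
  "refactor l m = (\<lambda>(x, x') (y, y'). \<forall>z. lax l x z ** lax m x' z = lax m y' z ** lax l y z)"

definition adler :: "real yb_map" where
  "adler l m = (\<lambda>(x, y) (x', y').
     x + y \<noteq> 0 \<and> x' = y - (l - m) / (x + y) \<and> y' = x - (m - l) / (x + y))"

section \<open>The bracket of the dressing chain in coordinates\<close>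

lemma linear_chain_g: "linear chain_g"
  by (rule linearI) (auto simp: chain_g_def vec_eq_iff algebra_simps)

lemma bij_chain_g:
  assumes gen: "surj (of_nat :: nat \<Rightarrow> 'n)" and odd: "odd CARD('n)"
  shows "bij (chain_g :: 'n rvec \<Rightarrow> 'n::{finite,comm_ring_1} rvec)"
proof -
  have "f = 0" if "chain_g f = 0" for f :: "'n rvec"
  proof -
    have *: "f $ (i + 1) = - f $ i" for i
    proof -
      have "f $ i + f $ (i + 1) = 0"
        using arg_cong[OF that, of "\<lambda>v. v $ i"] by (simp add: chain_g_def)
      then show ?thesis by linarith
    qed
    have pow: "f $ (of_nat k) = (-1) ^ k * f $ 0" for k
    proof (induction k)
      case (Suc k)
      have "f $ (of_nat (Suc k)) = f $ (of_nat k + 1)"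
        by (simp only: of_nat_Suc add.commute)
      then show ?case
        using *[of "of_nat k"] Suc by simp
    qed simp
    have card0: "of_nat CARD('n) = (0::'n)"
    proof -
      have bij: "bij (\<lambda>x::'n. x + 1)"
        by (rule bij_betwI[where g = "\<lambda>x. x - 1"]) auto
      have "(\<Sum>x\<in>UNIV. x + 1) = (\<Sum>x\<in>UNIV. x :: 'n)"
        using sum.reindex_bij_betw[OF bij, of "\<lambda>x. x"] by simp
      then show ?thesis
        by (simp add: sum.distrib)
    qed
    have "f $ 0 = 0"
      using pow[of "CARD('n)"] odd by (simp add: card0)
    then have "f $ i = 0" for i
    proof -
      obtain k where "i = of_nat k"
        using surjD[OF gen, of i] by blast
      then show ?thesis
        using pow[of k] \<open>f $ 0 = 0\<close> by simp
    qed
    then show ?thesis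
      by (simp add: vec_eq_iff)
  qed
  then have inj: "inj (chain_g :: 'n rvec \<Rightarrow> 'n rvec)"
    using linear_injective_0[OF linear_chain_g] by blast
  then show ?thesis
    using linear_injective_imp_surjective[OF linear_chain_g inj] by (simp add: bij_def)
qed

lemma chain_bracket_chain_g:
  assumes gen: "surj (of_nat :: nat \<Rightarrow> 'n)" and odd: "odd CARD('n)" and "3 \<le> CARD('n)"
  shows "chain_bracket (\<lambda>f. chain_g f $ j) (\<lambda>f. chain_g f $ k) (f :: 'n::{finite,comm_ring_1} rvec)
    = (if k = j + 1 then 1 else if j = k + 1 then -1 else 0)"
proof -
  have two: "(2::'n) \<noteq> 0"
  proof
    assume 2: "(2::'n) = 0"
    have "of_nat k \<in> {0, 1::'n}" for k
    proof (induction k)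
      case (Suc k)
      moreover have "1 + (1::'n) = 0"
        using 2 by (simp only: one_add_one)
      ultimately show ?case
        by (cases "of_nat k = (0::'n)") simp_all
    qed simp
    then have "range of_nat \<subseteq> {0, 1::'n}"
      by blast
    then have "UNIV \<subseteq> {0, 1::'n}"
      by (simp only: gen)
    then have "CARD('n) \<le> card {0, 1::'n}"
      by (intro card_mono) auto
    also have "\<dots> \<le> 2"
      by (simp add: card_insert_if)
    finally show False using assms(3) by simp
  qed
  have ne: "\<not> (k = j + 1 \<and> j = k + 1)"
  proof
    assume "k = j + 1 \<and> j = k + 1"
    then have "j = j + (1 + 1)"
      by (metis add.assoc)
    then show False
      using two by (simp only: one_add_one) simp
  qed
  have comp: "(\<lambda>f. chain_g f $ j) \<circ> inv chain_g = (\<lambda>g :: 'n rvec. g $ j)" for j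
    using bij_chain_g[OF gen odd] by (auto simp: fun_eq_iff bij_is_surj surj_f_inv_f)
  have der: "dir_deriv v (\<lambda>g :: 'n rvec. g $ j) x = v $ j" for v j x
  proof -
    have "((\<lambda>g :: 'n rvec. g $ j) has_derivative (\<lambda>v. v $ j)) (at x)"
      by (intro bounded_linear_imp_has_derivative bounded_linear_vec_nth)
    from frechet_derivative_at[OF this] show ?thesis by metis
  qed
  have "chain_bracket (\<lambda>f. chain_g f $ j) (\<lambda>f. chain_g f $ k) f =
    (\<Sum>i\<in>UNIV. (if i = j then if k = j + 1 then 1 else 0 else 0)
             - (if i = k then if j = k + 1 then 1 else 0 else 0))"
    unfolding chain_bracket_def comp der
    by (intro sum.cong refl) (auto simp: axis_def)
  also have "\<dots> = (if k = j + 1 then 1 else 0) - (if j = k + 1 then 1 else 0)"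
    by (simp add: sum_subtractf sum.delta)
  also have "\<dots> = (if k = j + 1 then 1 else if j = k + 1 then -1 else 0)"
    using ne by auto
  finally show ?thesis .
qed

end

theory Submission
  imports Defs
begin

text \<open>
  The sums \<open>u\<^sub>i = d\<^sub>i + a\<^sub>i\<^sub>+\<^sub>1\<close> separate the orbits of the action: they are invariant, because
  \<open>t\<^sub>i\<^sub>+\<^sub>1\<close> enters \<open>d\<^sub>i\<close> and \<open>a\<^sub>i\<^sub>+\<^sub>1\<close> with opposite signs, and two points with the same sums differ
  by the translation that matches their \<open>a\<close>-coordinates. At the representative \<open>a\<^sub>i = d\<^sub>i = f\<^sub>i\<close> they
  take the values \<open>g\<^sub>i = f\<^sub>i + f\<^sub>i\<^sub>+\<^sub>1\<close>. For odd \<open>N\<close> the \<open>g\<^sub>i\<close> are linear coordinates, so every orbit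
  has exactly one such representative, and functions on the quotient are functions of the \<open>g\<^sub>i\<close>.
  Since \<open>u\<^sub>i\<close> and \<open>u\<^sub>i\<^sub>+\<^sub>1\<close> share the conjugate pair \<open>(a\<^sub>i\<^sub>+\<^sub>1, d\<^sub>i\<^sub>+\<^sub>1)\<close> and no other two of the \<open>u\<close>'s
  share a pair, the bracket of the \<open>u\<close>'s is the bracket of the \<open>g\<close>'s (lemma
  \<open>leaf_bracket_comp_link\<close>).

  For the transfer maps, write the re-factorisation \<open>L L' = K' K\<close> in coordinates, with \<open>L\<close> at
  \<open>(a, d)\<close> and \<open>L'\<close> at \<open>(a', d')\<close>. If \<open>S = d + a'\<close> is not \<open>0\<close>, the first coordinate of \<open>K'\<close> must be
  \<open>a + c / S\<close> and the second one of \<open>K\<close> must be \<open>d' - c / S\<close>, where \<open>c\<close> is the difference of the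
  parameters; the other two coordinates again have the sum \<open>S\<close> and are otherwise free, the freedom
  being the translation that acts between \<open>K'\<close> and \<open>K\<close> (lemma \<open>refactor_iff\<close>). The Adler map
  does the same to numbers: it sends \<open>(x, y)\<close> with \<open>s = x + y\<close> to \<open>(y - c / s, x + c / s)\<close>, so it
  preserves \<open>s\<close> and shifts \<open>x\<close> and \<open>y\<close> as \<open>a\<close> and \<open>d'\<close> are shifted. Therefore, if the sums
  between consecutive factors of a product of matrices are the sums \<open>f\<^sub>p + f\<^sub>q\<close> of the corresponding
  numbers, this remains true when two neighbours are exchanged by re-factorisation and by the Adler
  map, respectively (lemma \<open>linked_step\<close>). The \<open>i\<close>-th transfer map moves the \<open>i\<close>-th factor once
  around the cycle; the resulting cyclic order is the original one, and the agreement of all sums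
  says that the orbits agree.

  Each Adler step is an involution of the open dense set where its denominator \<open>x + y\<close> does not
  vanish, because it preserves this denominator. Hence preimages of open dense sets under it are
  open and dense, and so is the domain of a composition of such steps.
\<close>

section \<open>Cyclic indices\<close>

lemma bij_plus_one: "bij (\<lambda>x::'a::comm_ring_1. x + 1)"
  by (rule bij_betwI[where g = "\<lambda>x. x - 1"]) auto

text \<open>
  Adding \<open>1\<close> permutes the elements and so leaves their sum unchanged.
\<close>

lemma of_nat_card_cyclic: "of_nat CARD('n) = (0::'n::{finite,comm_ring_1})"
proof -
  have "(\<Sum>x\<in>UNIV. x + 1) = (\<Sum>x\<in>UNIV. x :: 'n)"
    using sum.reindex_bij_betw[OF bij_plus_one, of "\<lambda>x. x"] by simp
  then show ?thesis
    by (simp add: sum.distrib)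
qed

lemma bij_betw_of_nat_cyclic:
  assumes gen: "surj (of_nat :: nat \<Rightarrow> 'n::{finite,comm_ring_1})"
  shows "bij_betw (of_nat :: nat \<Rightarrow> 'n) {..<CARD('n)} UNIV"
proof -
  have "x \<in> of_nat ` {..<CARD('n)}" for x :: 'n
  proof -
    obtain k where "x = of_nat k"
      using surjD[OF gen, of x] by blast
    also have "\<dots> = of_nat (k div CARD('n) * CARD('n) + k mod CARD('n))"
      by simp
    also have "\<dots> = of_nat (k mod CARD('n))"
      by (simp only: of_nat_add of_nat_mult of_nat_card_cyclic) simp
    finally show ?thesis
      by (rule image_eqI) simp
  qed
  then have onto: "of_nat ` {..<CARD('n)} = (UNIV :: 'n set)"
    by blast
  then have "inj_on (of_nat :: nat \<Rightarrow> 'n) {..<CARD('n)}"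
    by (intro eq_card_imp_inj_on) auto
  with onto show ?thesis
    by (simp add: bij_betw_def)
qed

lemma of_nat_cyclic_eq_iff:
  assumes "surj (of_nat :: nat \<Rightarrow> 'n::{finite,comm_ring_1})" "j < CARD('n)" "k < CARD('n)"
  shows "(of_nat j :: 'n) = of_nat k \<longleftrightarrow> j = k"
  using bij_betw_of_nat_cyclic[OF assms(1)] assms(2,3)
  by (auto simp: bij_betw_def inj_on_def)

lemma one_plus_one_neq_zero_cyclic:
  assumes "surj (of_nat :: nat \<Rightarrow> 'n::{finite,comm_ring_1})" "3 \<le> CARD('n)"
  shows "(1::'n) + 1 \<noteq> 0"
  using of_nat_cyclic_eq_iff[OF assms(1), of 2 0] assms(2) by simp

section \<open>Smooth functions and linear maps\<close>

lemma C_k_comp_bounded_linear: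
  assumes L: "bounded_linear L"
  shows "C_k k F \<Longrightarrow> C_k k (F \<circ> L)"
proof (induction k arbitrary: F)
  case 0
  then show ?case
    using continuous_on_compose2[OF _ linear_continuous_on[OF L], of UNIV F] by (simp add: comp_def)
next
  case (Suc k)
  have diff: "F differentiable (at y)" for y
    using Suc.prems by simp
  have der: "((F \<circ> L) has_derivative (frechet_derivative F (at (L x)) \<circ> L)) (at x)" for x
    by (intro diff_chain_at bounded_linear_imp_has_derivative L)
       (use diff in \<open>simp flip: frechet_derivative_works\<close>)
  have "C_k k (\<lambda>x. frechet_derivative (F \<circ> L) (at x) v)" for v
  proof -
    have "(\<lambda>x. frechet_derivative (F \<circ> L) (at x) v) = (\<lambda>y. frechet_derivative F (at y) (L v)) \<circ> L"
      unfolding frechet_derivative_at[OF der, symmetric] by (simp add: comp_def)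
    moreover have "C_k k (\<lambda>y. frechet_derivative F (at y) (L v))"
      using Suc.prems by simp
    ultimately show ?thesis
      using Suc.IH by metis
  qed
  moreover have "\<forall>x. F \<circ> L differentiable (at x)"
    using der differentiableI by blast
  ultimately show ?case
    unfolding C_k.simps by blast
qed

lemma smooth_comp_linear:
  fixes L :: "'a::euclidean_space \<Rightarrow> 'b::real_normed_vector"
  assumes "linear L" "smooth F"
  shows "smooth (F \<circ> L)"
  using assms C_k_comp_bounded_linear by (auto simp: smooth_def linear_conv_bounded_linear)

lemma smooth_has_derivative:
  assumes "smooth F"
  shows "(F has_derivative frechet_derivative F (at x)) (at x)"
proof -
  have "C_k (Suc 0) F"
    using assms by (simp only: smooth_def)
  then show ?thesis
    by (simp add: frechet_derivative_works)
qed

lemma dir_deriv_comp_linear: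
  fixes L :: "'a::euclidean_space \<Rightarrow> 'b::real_normed_vector"
  assumes "linear L" "smooth F"
  shows "dir_deriv v (F \<circ> L) x = dir_deriv (L v) F (L x)"
proof -
  have "((F \<circ> L) has_derivative (frechet_derivative F (at (L x)) \<circ> L)) (at x)"
    using assms
    by (intro diff_chain_at smooth_has_derivative bounded_linear_imp_has_derivative)
       (simp add: linear_conv_bounded_linear)
  from frechet_derivative_at[OF this, symmetric] show ?thesis
    by simp
qed

section \<open>The action and its Hamiltonians\<close>

lemma matrix_inv_t_hat: "matrix_inv (t_hat s) = t_hat (- s)"
proof -
  have inv: "t_hat s ** t_hat (- s) = mat 1" "t_hat (- s) ** t_hat s = mat 1"
    by (simp_all add: t_hat_def vec_eq_iff forall_2 matrix_matrix_mult_def sum_2 mat_def)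
  show ?thesis
    unfolding matrix_inv_def
    by (rule some_equality) (use inv in \<open>metis matrix_mul_assoc matrix_mul_lid matrix_mul_rid\<close>)+
qed

lemma leaf_gauge_iff_act: "leaf_gauge lam t x y \<longleftrightarrow> y = act t x"
proof -
  have conj: "t_hat r ** lax l v z ** t_hat (- s) = lax l (fst v + r, snd v - s) z" for r s l v z
    by (simp add: t_hat_def lax_def vec_eq_iff forall_2 matrix_matrix_mult_def sum_2 algebra_simps)
  have inj: "(\<forall>z. lax l v z = lax l w z) \<longleftrightarrow> v = w" for l v w
    by (auto simp: lax_def vec_eq_iff forall_2 prod_eq_iff)
  have "leaf_gauge lam t x y \<longleftrightarrow>
    (\<forall>i z. lax (lam $ i) (y $ i) z = lax (lam $ i) (act t x $ i) z)"
    by (simp add: leaf_gauge_def matrix_inv_t_hat act_def conj)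
  also have "\<dots> \<longleftrightarrow> y = act t x"
    by (simp only: inj) (simp add: vec_eq_iff)
  finally show ?thesis .
qed

lemma linear_ham: "linear (ham i)"
  by (rule linearI) (auto simp: ham_def algebra_simps)

text \<open>
  \<open>H\<^sub>i\<close> depends on \<open>d\<^sub>i\<close> and \<open>a\<^sub>i\<^sub>-\<^sub>1\<close> only, so its flow moves the conjugate variables \<open>a\<^sub>i\<close> and \<open>d\<^sub>i\<^sub>-\<^sub>1\<close>,
  with constant velocities \<open>1\<close> and \<open>-1\<close>.
\<close>

lemma leaf_bracket_ham:
  "leaf_bracket F (ham i) x = dir_deriv (axis i (1, 0)) F x - dir_deriv (axis (i - 1) (0, 1)) F x"
proof -
  have der: "dir_deriv v (ham i) x = ham i v" for v
  proof -
    have "(ham i has_derivative ham i) (at x)"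
      using linear_ham[of i] by (simp add: bounded_linear_imp_has_derivative linear_conv_bounded_linear)
    from frechet_derivative_at[OF this] show ?thesis
      by metis
  qed
  have "leaf_bracket F (ham i) x =
    (\<Sum>k\<in>UNIV. (if k = i then dir_deriv (axis k (1, 0)) F x else 0)
             - (if k = i - 1 then dir_deriv (axis k (0, 1)) F x else 0))"
    unfolding leaf_bracket_def der
    by (intro sum.cong refl) (auto simp: ham_def axis_def)
  then show ?thesis
    by (simp add: sum_subtractf sum.delta)
qed

lemma act_has_derivative_bracket:
  fixes F :: "'n::{finite,comm_ring_1} phase \<Rightarrow> real"
  assumes F: "smooth F"
  shows "((\<lambda>s. F (act (axis i s) x)) has_real_derivative
           leaf_bracket F (ham i) (act (axis i s) x)) (at s)"
proof -
  define v :: "'n phase" where "v = axis i (1, 0) - axis (i - 1) (0, 1)"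
  have line: "act (axis i s) x = x + s *\<^sub>R v" for s
    by (auto simp: act_def v_def vec_eq_iff axis_def prod_eq_iff)
  have lin: "linear (frechet_derivative F (at y))" for y
    using has_derivative_linear[OF smooth_has_derivative[OF F]] .
  have "((\<lambda>s. x + s *\<^sub>R v) has_derivative (\<lambda>h. h *\<^sub>R v)) (at s)"
    by (auto intro!: derivative_eq_intros)
  from diff_chain_at[OF this smooth_has_derivative[OF F]]
  have "((\<lambda>s. F (x + s *\<^sub>R v)) has_derivative
      (\<lambda>h. frechet_derivative F (at (x + s *\<^sub>R v)) (h *\<^sub>R v))) (at s)"
    by (simp add: comp_def)
  then have "((\<lambda>s. F (x + s *\<^sub>R v)) has_real_derivative
      frechet_derivative F (at (x + s *\<^sub>R v)) v) (at s)"
    by (simp add: has_field_derivative_def linear_cmul[OF lin] mult_commute_abs)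
  also have "frechet_derivative F (at (x + s *\<^sub>R v)) v = leaf_bracket F (ham i) (x + s *\<^sub>R v)"
    by (simp add: leaf_bracket_ham v_def linear_diff[OF lin])
  finally show ?thesis
    by (simp add: line)
qed

section \<open>The quotient\<close>

definition link :: "'n phase \<Rightarrow> 'n::{finite,comm_ring_1} rvec" where
  "link x = (\<chi> i. snd (x $ i) + fst (x $ (i + 1)))"

definition diag :: "'n rvec \<Rightarrow> 'n::finite phase" where
  "diag f = (\<chi> i. (f $ i, f $ i))"

lemma linear_link: "linear link"
  by (rule linearI) (auto simp: link_def vec_eq_iff algebra_simps)

lemma linear_diag: "linear diag"
  by (rule linearI) (auto simp: diag_def vec_eq_iff)

lemma link_diag: "link (diag f) = chain_g f"
  by (simp add: link_def diag_def chain_g_def)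

lemma orbit_rel_iff_link: "(x, y) \<in> orbit_rel lam \<longleftrightarrow> link y = link x"
proof
  assume "(x, y) \<in> orbit_rel lam"
  then obtain t where "y = act t x"
    by (auto simp: orbit_rel_def leaf_gauge_iff_act)
  then show "link y = link x"
    by (simp add: link_def act_def)
next
  assume *: "link y = link x"
  define t where "t = (\<chi> i. fst (y $ i) - fst (x $ i))"
  have "snd (y $ i) = snd (x $ i) - t $ (i + 1)" for i
    using arg_cong[OF *, of "\<lambda>v. v $ i"] by (simp add: link_def t_def)
  then have "y = act t x"
    by (simp add: act_def vec_eq_iff prod_eq_iff t_def)
  then show "(x, y) \<in> orbit_rel lam"
    by (auto simp: orbit_rel_def leaf_gauge_iff_act)
qed

lemma proj_eq_fibre: "proj lam x = {y. link y = link x}"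
  by (auto simp: proj_def orbit_rel_iff_link)

lemma proj_eq_iff: "proj lam x = proj lam y \<longleftrightarrow> link x = link y"
  by (auto simp: proj_eq_fibre)

lemma chain_class_eq_proj_diag: "chain_class lam f = proj lam (diag f)"
  by (simp add: chain_class_def diag_def)

lemma chain_class_eq_fibre: "chain_class lam f = {y. link y = chain_g f}"
  by (simp add: chain_class_eq_proj_diag proj_eq_fibre link_diag)

lemma proj_eq_chain_class:
  assumes "bij (chain_g :: 'n rvec \<Rightarrow> 'n::{finite,comm_ring_1} rvec)"
  shows "proj lam (x :: 'n phase) = chain_class lam (inv chain_g (link x))"
  using assms by (simp add: chain_class_eq_fibre proj_eq_fibre bij_is_surj surj_f_inv_f)

lemma linear_inv_chain_g:
  assumes "bij (chain_g :: 'n rvec \<Rightarrow> 'n::{finite,comm_ring_1} rvec)"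
  shows "linear (inv chain_g :: 'n rvec \<Rightarrow> 'n rvec)"
proof (rule linearI)
  have cancel: "inv chain_g (chain_g f) = f" "chain_g (inv chain_g g) = g" for f g :: "'n rvec"
    using assms by (simp_all add: bij_is_inj bij_is_surj surj_f_inv_f)
  show "inv chain_g (g + h) = inv chain_g g + inv chain_g h" for g h :: "'n rvec"
    by (metis cancel linear_add[OF linear_chain_g])
  show "inv chain_g (c *\<^sub>R g) = c *\<^sub>R inv chain_g g" for c and g :: "'n rvec"
    by (metis cancel linear_cmul[OF linear_chain_g])
qed

lemma bij_betw_chain_class:
  assumes "bij (chain_g :: 'n rvec \<Rightarrow> 'n::{finite,comm_ring_1} rvec)"
  shows "bij_betw (chain_class lam) (UNIV :: 'n rvec set) (reduced_space lam)"
proof -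
  have "inj (chain_class lam :: 'n rvec \<Rightarrow> _)"
    using injD[OF bij_is_inj[OF assms]]
    by (auto intro!: injI simp: chain_class_eq_proj_diag proj_eq_iff link_diag)
  moreover have "reduced_space lam = range (proj lam :: 'n phase \<Rightarrow> _)"
    by (auto simp: reduced_space_def quotient_def proj_def)
  then have "range (chain_class lam) = (reduced_space lam :: 'n phase set set)"
    by (metis chain_class_eq_proj_diag proj_eq_chain_class[OF assms] image_subsetI
        rangeI subset_antisym)
  ultimately show ?thesis
    by (simp add: bij_betw_def)
qed

text \<open>
  In the coordinates \<open>f\<close> of the quotient both the quotient map and its section \<open>diag\<close> are linear, so
  a function on one side is a linear pull-back of the function on the other side.
\<close>

lemma smooth_proj_iff_smooth_chain_class:
  assumes bij: "bij (chain_g :: 'n rvec \<Rightarrow> 'n::{finite,comm_ring_1} rvec)"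
  shows "smooth (\<phi> \<circ> proj lam) \<longleftrightarrow> smooth (\<phi> \<circ> (chain_class lam :: 'n rvec \<Rightarrow> _))"
proof
  assume "smooth (\<phi> \<circ> proj lam)"
  from smooth_comp_linear[OF linear_diag this] show "smooth (\<phi> \<circ> chain_class lam)"
    by (simp add: comp_def chain_class_eq_proj_diag)
next
  assume "smooth (\<phi> \<circ> chain_class lam)"
  from smooth_comp_linear[OF linear_compose[OF linear_link linear_inv_chain_g[OF bij]] this]
  show "smooth (\<phi> \<circ> proj lam)"
    by (simp add: comp_def proj_eq_chain_class[OF bij])
qed

section \<open>The reduced bracket\<close>

definition cyclic_bracket ::
  "('n rvec \<Rightarrow> real) \<Rightarrow> ('n rvec \<Rightarrow> real) \<Rightarrow> 'n::{finite,comm_ring_1} rvec \<Rightarrow> real" where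
  "cyclic_bracket P Q g =
     (\<Sum>i\<in>UNIV. dir_deriv (axis i 1) P g * dir_deriv (axis (i + 1) 1) Q g
              - dir_deriv (axis (i + 1) 1) P g * dir_deriv (axis i 1) Q g)"

lemma chain_bracket_eq_cyclic_bracket:
  "chain_bracket F G f = cyclic_bracket (F \<circ> inv chain_g) (G \<circ> inv chain_g) (chain_g f)"
  by (simp add: chain_bracket_def cyclic_bracket_def)

text \<open>
  The coordinate \<open>a\<^sub>i\<close> occurs in \<open>u\<^sub>i\<^sub>-\<^sub>1\<close> only and \<open>d\<^sub>i\<close> in \<open>u\<^sub>i\<close> only, so the \<open>i\<close>-th conjugate pair
  contributes the bracket between \<open>u\<^sub>i\<^sub>-\<^sub>1\<close> and \<open>u\<^sub>i\<close>.
\<close>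

lemma leaf_bracket_comp_link:
  fixes P Q :: "'n::{finite,comm_ring_1} rvec \<Rightarrow> real"
  assumes "smooth P" "smooth Q"
  shows "leaf_bracket (P \<circ> link) (Q \<circ> link) x = cyclic_bracket P Q (link x)"
proof -
  have a: "link (axis (i + 1) (1, 0)) = axis i 1" and d: "link (axis i (0, 1)) = axis i 1"
    for i :: 'n
    by (auto simp: link_def vec_eq_iff axis_def)
  have "leaf_bracket (P \<circ> link) (Q \<circ> link) x =
    (\<Sum>i\<in>UNIV. dir_deriv (link (axis i (1, 0))) P (link x) * dir_deriv (axis i 1) Q (link x)
              - dir_deriv (axis i 1) P (link x) * dir_deriv (link (axis i (1, 0))) Q (link x))"
    by (simp add: leaf_bracket_def dir_deriv_comp_linear linear_link assms d)
  also have "\<dots> = cyclic_bracket P Q (link x)"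
    unfolding cyclic_bracket_def by (subst sum.reindex_bij_betw[OF bij_plus_one, symmetric]) (simp add: a)
  finally show ?thesis .
qed

lemma reduced_bracket_eq:
  assumes bij: "bij (chain_g :: 'n rvec \<Rightarrow> 'n::{finite,comm_ring_1} rvec)"
    and \<phi>: "smooth (\<phi> \<circ> proj lam)" and \<psi>: "smooth (\<psi> \<circ> proj lam)"
  shows "leaf_bracket (\<phi> \<circ> proj lam) (\<psi> \<circ> proj lam) (x :: 'n phase)
           = reduced_bracket lam \<phi> \<psi> (proj lam x)"
    and "reduced_bracket lam \<phi> \<psi> (chain_class lam f)
           = chain_bracket (\<phi> \<circ> chain_class lam) (\<psi> \<circ> chain_class lam) f"
proof -
  \<comment> \<open>The function on the quotient, in the coordinates \<open>g\<close>.\<close>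
  define D where "D \<eta> = \<eta> \<circ> chain_class lam \<circ> inv chain_g" for \<eta> :: "'n phase set \<Rightarrow> real"
  have proj: "\<eta> \<circ> proj lam = D \<eta> \<circ> link" for \<eta>
    by (simp add: D_def fun_eq_iff proj_eq_chain_class[OF bij])
  have smooth: "smooth (D \<eta>)" if "smooth (\<eta> \<circ> proj lam)" for \<eta>
    using that unfolding D_def
    by (intro smooth_comp_linear linear_inv_chain_g bij)
       (simp add: smooth_proj_iff_smooth_chain_class[OF bij])
  have leaf: "leaf_bracket (\<phi> \<circ> proj lam) (\<psi> \<circ> proj lam) y
      = cyclic_bracket (D \<phi>) (D \<psi>) (link y)" for y
    unfolding proj by (intro leaf_bracket_comp_link smooth \<phi> \<psi>)
  have red: "reduced_bracket lam \<phi> \<psi> (proj lam y) = cyclic_bracket (D \<phi>) (D \<psi>) (link y)" for y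
    unfolding reduced_bracket_def
    by (rule the_equality) (auto simp: leaf proj_eq_fibre)
  show "leaf_bracket (\<phi> \<circ> proj lam) (\<psi> \<circ> proj lam) x = reduced_bracket lam \<phi> \<psi> (proj lam x)"
    by (simp only: leaf red)
  show "reduced_bracket lam \<phi> \<psi> (chain_class lam f)
      = chain_bracket (\<phi> \<circ> chain_class lam) (\<psi> \<circ> chain_class lam) f"
    by (simp only: chain_class_eq_proj_diag[of lam f] red link_diag
        chain_bracket_eq_cyclic_bracket D_def)
qed

section \<open>The domain of the transfer maps of the Adler map\<close>

definition adler_step :: "real \<Rightarrow> 'n \<Rightarrow> 'n \<Rightarrow> 'n rvec \<Rightarrow> 'n::finite rvec" where
  "adler_step c i j f = (\<chi> k. if k = i then f $ j - c / (f $ i + f $ j)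
     else if k = j then f $ i + c / (f $ i + f $ j) else f $ k)"

lemma yb_at_adler:
  assumes "i \<noteq> j"
  shows "(f, f') \<in> yb_at adler lam i j \<longleftrightarrow>
    f $ i + f $ j \<noteq> 0 \<and> f' = adler_step (lam $ i - lam $ j) i j f"
  using assms by (auto simp: yb_at_def adler_def adler_step_def vec_eq_iff diff_divide_distrib)

lemma adler_step_sum:
  assumes "i \<noteq> j"
  shows "adler_step c i j f $ i + adler_step c i j f $ j = f $ i + f $ j"
  using assms by (simp add: adler_step_def)

lemma adler_step_involution:
  assumes "i \<noteq> j"
  shows "adler_step c i j (adler_step c i j f) = f"
proof -
  have "adler_step c i j (adler_step c i j f) $ k = f $ k" for k
    using assms adler_step_sum[OF assms, of c f]
    by (subst adler_step_def) (simp add: adler_step_def)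
  then show ?thesis
    by (simp add: vec_eq_iff)
qed

lemma closure_UNIV_iff_meets_open:
  "closure S = UNIV \<longleftrightarrow> (\<forall>U. open U \<longrightarrow> U \<noteq> {} \<longrightarrow> U \<inter> S \<noteq> {})"
proof
  assume "closure S = UNIV"
  then show "\<forall>U. open U \<longrightarrow> U \<noteq> {} \<longrightarrow> U \<inter> S \<noteq> {}"
    using open_Int_closure_eq_empty[of _ S] by auto
next
  assume *: "\<forall>U. open U \<longrightarrow> U \<noteq> {} \<longrightarrow> U \<inter> S \<noteq> {}"
  have "- closure S \<inter> S = {}"
    using closure_subset[of S] by blast
  with * have "- closure S = {}"
    by (metis closed_closure open_Compl)
  then show "closure S = UNIV"
    by blast
qed

lemma open_dense_vimage_involution:
  assumes D: "open D" "closure D = UNIV"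
    and h: "continuous_on D h" "\<And>x. x \<in> D \<Longrightarrow> h x \<in> D" "\<And>x. x \<in> D \<Longrightarrow> h (h x) = x"
    and V: "open V" "closure V = UNIV"
  shows "open (D \<inter> h -` V)" "closure (D \<inter> h -` V) = UNIV"
proof -
  have op: "open (D \<inter> h -` U)" if "open U" for U
    using continuous_open_preimage[OF h(1) D(1) that] .
  show "open (D \<inter> h -` V)"
    by (rule op[OF V(1)])
  show "closure (D \<inter> h -` V) = UNIV"
    unfolding closure_UNIV_iff_meets_open
  proof (intro allI impI)
    fix U :: "'a set" assume U: "open U" "U \<noteq> {}"
    then obtain x where x: "x \<in> U" "x \<in> D"
      using D(2) unfolding closure_UNIV_iff_meets_open by blast
    \<comment> \<open>The image of \<open>U \<inter> D\<close> under \<open>h\<close> is also its preimage, hence open, and so it meets \<open>V\<close>.\<close>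
    have "open (D \<inter> h -` U)" "h x \<in> D \<inter> h -` U"
      using op[OF U(1)] x h by auto
    then obtain y where y: "y \<in> D" "h y \<in> U" "y \<in> V"
      using V(2) unfolding closure_UNIV_iff_meets_open by blast
    then have "h y \<in> U \<inter> (D \<inter> h -` V)"
      using h by auto
    then show "U \<inter> (D \<inter> h -` V) \<noteq> {}"
      by blast
  qed
qed

text \<open>
  Stated for preimages of sets and not just for the domain, because in this form the property
  passes to compositions.
\<close>

lemma open_dense_preimage_yb_at_adler:
  assumes "i \<noteq> j" and V: "open V" "closure V = UNIV"
  shows "open ((yb_at adler lam i j)\<inverse> `` V)" "closure ((yb_at adler lam i j)\<inverse> `` V) = UNIV"
proof -
  define D where "D = {f :: 'a rvec. f $ i + f $ j \<noteq> 0}"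
  define h where "h = adler_step (lam $ i - lam $ j) i j"
  have eq: "(yb_at adler lam i j)\<inverse> `` V = D \<inter> h -` V"
    by (auto simp: yb_at_adler[OF \<open>i \<noteq> j\<close>] D_def h_def)
  have "open D"
    unfolding D_def by (intro open_Collect_neq continuous_intros)
  moreover have "closure D = UNIV"
  proof -
    \<comment> \<open>The complement of \<open>D\<close> is the hyperplane with normal vector \<open>n\<close>.\<close>
    define n :: "'a rvec" where "n = axis i 1 + axis j 1"
    have "n $ i = 1"
      using \<open>i \<noteq> j\<close> by (simp add: n_def axis_def)
    then have "n \<noteq> 0"
      by auto
    moreover have "D = - {f. n \<bullet> f = 0}"
      by (auto simp: D_def n_def inner_add_left inner_axis')
    ultimately show ?thesis
      by (simp add: closure_complement)
  qed
  moreover have "continuous_on D h"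
    unfolding h_def adler_step_def
    apply (rule continuous_on_vec_lambda)
    subgoal for k
      by (cases "k = i"; cases "k = j") (auto simp: D_def intro!: continuous_intros)
    done
  moreover have "h f \<in> D" if "f \<in> D" for f
    using that adler_step_sum[OF \<open>i \<noteq> j\<close>] by (simp add: D_def h_def)
  moreover have "h (h f) = f" for f
    by (simp add: h_def adler_step_involution[OF \<open>i \<noteq> j\<close>])
  ultimately show "open ((yb_at adler lam i j)\<inverse> `` V)"
    "closure ((yb_at adler lam i j)\<inverse> `` V) = UNIV"
    using open_dense_vimage_involution[of D h V] V unfolding eq by blast+
qed

lemma plus_of_nat_cyclic_neq:
  assumes "surj (of_nat :: nat \<Rightarrow> 'n::{finite,comm_ring_1})" "0 < m" "m < CARD('n)"
  shows "i \<noteq> i + (of_nat m :: 'n)"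
  using of_nat_cyclic_eq_iff[OF assms(1,3), of 0] assms(2) by auto

lemma single_valued_transfer_adler:
  assumes gen: "surj (of_nat :: nat \<Rightarrow> 'n)"
  shows "single_valued (transfer adler (lam :: 'n::{finite,comm_ring_1} rvec) i)"
proof -
  have "single_valued (transfer_upto adler lam i k)" if "k < CARD('n)" for k
    using that
  proof (induction k)
    case (Suc k)
    have "i \<noteq> i + of_nat (Suc k)"
      using plus_of_nat_cyclic_neq[OF gen _ Suc.prems] by blast
    then have "single_valued (yb_at adler lam i (i + of_nat (Suc k)))"
      by (auto simp: single_valued_def yb_at_adler simp del: of_nat_Suc)
    with Suc show ?case
      by (simp add: single_valued_relcomp del: of_nat_Suc)
  qed simp
  then show ?thesis
    by (simp add: transfer_def)
qed

lemma open_dense_Domain_transfer_adler: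
  assumes gen: "surj (of_nat :: nat \<Rightarrow> 'n)"
  shows "open (Domain (transfer adler (lam :: 'n::{finite,comm_ring_1} rvec) i))"
    and "closure (Domain (transfer adler lam i)) = UNIV"
proof -
  have "open ((transfer_upto adler lam i k)\<inverse> `` V) \<and>
      closure ((transfer_upto adler lam i k)\<inverse> `` V) = UNIV"
    if "k < CARD('n)" "open V" "closure V = UNIV" for k V
    using that
  proof (induction k arbitrary: V)
    case (Suc k)
    have "i \<noteq> i + of_nat (Suc k)"
      using plus_of_nat_cyclic_neq[OF gen _ Suc.prems(1)] by blast
    from open_dense_preimage_yb_at_adler[OF this Suc.prems(2,3), of lam] Suc
    show ?case
      by (simp add: converse_relcomp relcomp_Image del: of_nat_Suc)
  qed simp
  from this[of "CARD('n) - 1" UNIV]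
  have "open ((transfer adler lam i)\<inverse> `` UNIV) \<and> closure ((transfer adler lam i)\<inverse> `` UNIV) = UNIV"
    by (simp add: transfer_def)
  moreover have "(transfer adler lam i)\<inverse> `` UNIV = Domain (transfer adler lam i)"
    by auto
  ultimately show "open (Domain (transfer adler lam i))"
    "closure (Domain (transfer adler lam i)) = UNIV"
    by simp_all
qed

section \<open>Re-factorisation covers the Adler map\<close>

text \<open>
  If \<open>d + a'\<close> is not \<open>0\<close>, the entries of the two products agree for all \<open>z\<close> as soon as the diagonal entries agree at \<open>0\<close>
  and the two sums \<open>d + a'\<close> (the lower left entries) agree. The free parameter that remains is the
  translation acting between the two new factors.
\<close>

lemma refactor_iff:
  assumes "snd x + fst x' \<noteq> 0"
  shows "refactor l m (x, x') (y, y') \<longleftrightarrow>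
    snd y' + fst y = snd x + fst x' \<and>
    fst y' = fst x + (l - m) / (snd x + fst x') \<and>
    snd y = snd x' - (l - m) / (snd x + fst x')"
    (is "?ref \<longleftrightarrow> ?sol")
proof -
  obtain a d a' d' b e b' e' where
    [simp]: "x = (a, d)" "x' = (a', d')" "y = (b, e)" "y' = (b', e')"
    by (metis surj_pair)
  have S: "d + a' \<noteq> 0"
    using assms by simp
  show ?thesis
  proof
    assume ?ref
    then have eq: "lax l (a, d) 0 ** lax m (a', d') 0 = lax m (b', e') 0 ** lax l (b, e) 0"
      by (simp add: refactor_def)
    have sum: "e' + b = d + a'"
      using arg_cong[OF eq, of "\<lambda>A. A $ 2 $ 1"]
      by (simp add: lax_def matrix_matrix_mult_def sum_2)
    have "(d + a') * (b' - a) = l - m"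
      using arg_cong[OF eq, of "\<lambda>A. A $ 1 $ 1"]
      by (simp add: lax_def matrix_matrix_mult_def sum_2 sum[symmetric] algebra_simps)
         (use sum in algebra)
    moreover have "(d + a') * (d' - e) = l - m"
      using arg_cong[OF eq, of "\<lambda>A. A $ 2 $ 2"]
      by (simp add: lax_def matrix_matrix_mult_def sum_2 algebra_simps)
         (use sum in algebra)
    ultimately show ?sol
      using S sum by (simp add: field_simps)
  next
    assume sol: ?sol
    define c where "c = (l - m) / (d + a')"
    have m: "m = l - c * (d + a')" and d: "d = e' + b - a'" and b': "b' = a + c" and e: "e = d' - c"
      using S sol by (simp_all add: c_def)
    show ?ref
      unfolding refactor_def
      by (simp add: lax_def matrix_matrix_mult_def sum_2 vec_eq_iff forall_2)
         (simp add: m d b' e algebra_simps)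
  qed
qed

text \<open>
  Here \<open>\<rho> p\<close> is the index of the factor at position \<open>p\<close> of a product of matrices, the
  positions being arranged in a cycle.
\<close>

definition linked :: "('n \<Rightarrow> 'n) \<Rightarrow> 'n phase \<Rightarrow> 'n::{finite,comm_ring_1} rvec \<Rightarrow> bool" where
  "linked \<rho> x f \<longleftrightarrow>
     (\<forall>p. snd (x $ \<rho> p) + fst (x $ \<rho> (p + 1)) = f $ \<rho> p + f $ \<rho> (p + 1))"

lemma link_eq_chain_g_iff_linked: "link x = chain_g f \<longleftrightarrow> linked id x f"
  by (simp add: link_def chain_g_def linked_def vec_eq_iff)

lemma linked_succ_iff: "linked (\<lambda>p. p + 1) x f \<longleftrightarrow> linked id (x :: 'n::{finite,comm_ring_1} phase) f"
  unfolding linked_def id_def by (metis diff_add_cancel)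

text \<open>
  The exchange affects the sums at the positions \<open>p - 1\<close>, \<open>p\<close> and \<open>p + 1\<close> only. The middle one is the denominator of
  both maps, which is preserved. By the exchange the factor before the pair loses the neighbour
  with coordinate \<open>a\<^sub>i\<close> and gets one with \<open>a\<^sub>i + c / s\<close>, while \<open>f\<^sub>i\<close> is replaced by \<open>f\<^sub>i + c / s\<close>;
  likewise, with the opposite sign, after the pair.
\<close>

lemma linked_step:
  fixes p :: "'n::{finite,comm_ring_1}"
  assumes two: "(1::'n) + 1 \<noteq> 0" and inj: "inj \<rho>" and ij: "\<rho> p = i" "\<rho> (p + 1) = j"
    and lnk: "linked \<rho> x f"
    and f': "(f, f') \<in> yb_at adler lam i j" and x': "(x, x') \<in> yb_at refactor lam i j"
  shows "linked (\<rho> \<circ> Transposition.transpose p (p + 1)) x' f'"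
proof -
  have sums: "snd (x $ \<rho> q) + fst (x $ \<rho> (q + 1)) = f $ \<rho> q + f $ \<rho> (q + 1)" for q
    using lnk by (simp add: linked_def)
  have ne: "i \<noteq> j"
    using inj_eq[OF inj, of p "p + 1"] ij by simp
  define s where "s = f $ i + f $ j"
  define c where "c = (lam $ i - lam $ j) / s"
  have s: "s \<noteq> 0" and f'i: "f' $ i = f $ j - c" and f'j: "f' $ j = f $ i + c"
    using f' ne by (auto simp: yb_at_adler[OF ne] adler_step_def s_def c_def)
  have f'k: "f' $ k = f $ k" and x'k: "x' $ k = x $ k" if "k \<noteq> i" "k \<noteq> j" for k
    using f' x' that by (auto simp: yb_at_def)
  have S: "snd (x $ i) + fst (x $ j) = s"
    using sums[of p] ij by (simp add: s_def)
  have "refactor (lam $ i) (lam $ j) (x $ i, x $ j) (x' $ i, x' $ j)"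
    using x' by (simp add: yb_at_def)
  then have new: "snd (x' $ j) + fst (x' $ i) = s" "fst (x' $ j) = fst (x $ i) + c"
    "snd (x' $ i) = snd (x $ j) - c"
    using s S by (simp_all add: refactor_iff c_def)
  let ?\<tau> = "Transposition.transpose p (p + 1)"
  show ?thesis
    unfolding linked_def comp_apply
  proof
    fix q
    have other: "\<rho> r \<noteq> i" "\<rho> r \<noteq> j" if "r \<noteq> p" "r \<noteq> p + 1" for r
      using that by (simp_all add: inj_eq[OF inj] flip: ij)
    \<comment> \<open>The cycle has more than two positions, so the neighbours of the pair are outside the pair.\<close>
    have succ2: "p + 1 + 1 \<noteq> p" "p + 1 + 1 \<noteq> p + 1"
      using two by (simp add: add.assoc, simp)
    consider "q = p" | "q + 1 = p" | "q = p + 1" | "q \<noteq> p" "q + 1 \<noteq> p" "q \<noteq> p + 1"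
      by blast
    then show "snd (x' $ \<rho> (?\<tau> q)) + fst (x' $ \<rho> (?\<tau> (q + 1)))
        = f' $ \<rho> (?\<tau> q) + f' $ \<rho> (?\<tau> (q + 1))"
    proof cases
      case 1
      then show ?thesis
        using ij new f'i f'j by (simp add: s_def)
    next
      case 2
      then have "q \<noteq> p" "q \<noteq> p + 1"
        using succ2 by auto
      then show ?thesis
        using 2 other[of q] ij new f'j f'k x'k sums[of q] by simp
    next
      case 3
      have "?\<tau> (p + 1 + 1) = p + 1 + 1"
        using succ2 by (intro transpose_apply_other) auto
      then show ?thesis
        using 3 other[of "p + 1 + 1"] succ2 ij new f'i f'k x'k sums[of "p + 1"] by simp
    next
      case 4
      then have "q + 1 \<noteq> p" "q + 1 \<noteq> p + 1"
        by auto
      then show ?thesis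
        using 4 other[of q] other[of "q + 1"] f'k x'k sums[of q] by simp
    qed
  qed
qed

lemma refactor_step_exists:
  assumes "i \<noteq> j" "snd (x $ i) + fst (x $ j) \<noteq> 0"
  shows "\<exists>x'. (x, x') \<in> yb_at refactor lam i j"
proof -
  define s c where "s = snd (x $ i) + fst (x $ j)" and "c = (lam $ i - lam $ j) / s"
  \<comment> \<open>The free translation is used to make the second coordinate of the new \<open>j\<close>-th factor \<open>0\<close>.\<close>
  define x' where "x' = (\<chi> k. if k = i then (s, snd (x $ j) - c)
    else if k = j then (fst (x $ i) + c, 0) else x $ k)"
  have "refactor (lam $ i) (lam $ j) (x $ i, x $ j) (x' $ i, x' $ j)"
    using assms by (simp add: refactor_iff) (simp add: x'_def s_def c_def)
  then have "(x, x') \<in> yb_at refactor lam i j"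
    by (simp add: yb_at_def x'_def)
  then show ?thesis ..
qed

text \<open>
  \<open>factor_at i k p\<close> is the index of the factor at position \<open>p\<close> after the factor \<open>i\<close> has been
  exchanged with its next \<open>k\<close> neighbours.
\<close>

primrec factor_at :: "'n \<Rightarrow> nat \<Rightarrow> 'n::{finite,comm_ring_1} \<Rightarrow> 'n" where
  "factor_at i 0 = id"
| "factor_at i (Suc k) =
     factor_at i k \<circ> Transposition.transpose (i + of_nat k) (i + of_nat k + 1)"

lemma inj_factor_at: "inj (factor_at i k)"
  by (induction k) (auto intro!: inj_compose simp del: o_apply simp: bij_is_inj)

lemma factor_at_eq:
  fixes i :: "'n::{finite,comm_ring_1}"
  assumes gen: "surj (of_nat :: nat \<Rightarrow> 'n)" and "k < CARD('n)" "j < CARD('n)"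
  shows "factor_at i k (i + of_nat j) =
    (if j < k then i + of_nat (Suc j) else if j = k then i else i + of_nat j)"
  using assms(2,3)
proof (induction k arbitrary: j)
  case (Suc k)
  have next_eq: "i + of_nat k + 1 = i + of_nat (Suc k)"
    by simp
  have eq_iff: "i + of_nat j = i + of_nat m \<longleftrightarrow> j = m" if "m < CARD('n)" for m
    using of_nat_cyclic_eq_iff[OF gen Suc.prems(2) that] by simp
  consider "j = k" | "j = Suc k" | "j \<noteq> k" "j \<noteq> Suc k"
    by blast
  then show ?case
  proof cases
    case 1
    then show ?thesis
      using Suc.IH[of "Suc k"] Suc.prems by (simp add: next_eq del: of_nat_Suc)
  next
    case 2
    then show ?thesis
      using Suc.IH[of k] Suc.prems by (simp add: next_eq del: of_nat_Suc)
  next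
    case 3
    then have "Transposition.transpose (i + of_nat k) (i + of_nat k + 1) (i + of_nat j) = i + of_nat j"
      unfolding next_eq using Suc.prems eq_iff[of k] eq_iff[of "Suc k"]
      by (intro transpose_apply_other) auto
    then show ?thesis
      using Suc.IH[of j] Suc.prems 3 by (auto simp del: of_nat_Suc)
  qed
qed simp

text \<open>
  Once the factor \<open>i\<close> has passed all the others, it stands at the end, and each of the others has
  moved one place towards the beginning.
\<close>

lemma factor_at_full_cycle:
  fixes i :: "'n::{finite,comm_ring_1}"
  assumes gen: "surj (of_nat :: nat \<Rightarrow> 'n)"
  shows "factor_at i (CARD('n) - 1) = (\<lambda>p. p + 1)"
proof
  fix p
  have bij: "bij_betw (of_nat :: nat \<Rightarrow> 'n) {..<CARD('n)} UNIV"
    by (rule bij_betw_of_nat_cyclic[OF gen])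
  obtain j where j: "j < CARD('n)" "p - i = of_nat j"
    using bij_betw_imp_surj_on[OF bij] by (metis UNIV_I image_iff lessThan_iff)
  then have p: "p = i + of_nat j"
    by (metis add.commute diff_add_cancel)
  show "factor_at i (CARD('n) - 1) p = p + 1"
  proof (cases "j < CARD('n) - 1")
    case True
    then show ?thesis
      using j by (simp add: p factor_at_eq[OF gen] algebra_simps)
  next
    case False
    then have last: "j = CARD('n) - 1"
      using j by simp
    \<comment> \<open>The successor of the last position is \<open>i + N = i\<close>, since the cycle has been exhausted.\<close>
    then have "of_nat (Suc j) = (0::'n)"
      using of_nat_card_cyclic by simp
    then have "p + 1 = i"
      by (simp add: p add.assoc add.commute[of _ 1])
    moreover have "factor_at i (CARD('n) - 1) (i + of_nat j) = i"
      using factor_at_eq[OF gen, of "CARD('n) - 1" j i] j(1) last by simp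
    ultimately show ?thesis
      by (simp only: p)
  qed
qed

text \<open>
  As long as the sums agree, the denominators of the Adler steps are also those of the
  re-factorisations, so wherever the Adler side is defined, the re-factorisations exist and
  \<open>linked_step\<close> applies.
\<close>

lemma transfer_upto_refactor:
  fixes lam :: "'n::{finite,comm_ring_1} rvec"
  assumes gen: "surj (of_nat :: nat \<Rightarrow> 'n)" and N: "3 \<le> CARD('n)" and "k < CARD('n)"
    and "linked id x f" "(f, f') \<in> transfer_upto adler lam i k"
  shows "(\<exists>x'. (x, x') \<in> transfer_upto refactor lam i k) \<and>
    (\<forall>x'. (x, x') \<in> transfer_upto refactor lam i k \<longrightarrow> linked (factor_at i k) x' f')"
  using assms(3-5)
proof (induction k arbitrary: f')
  case (Suc k)
  define j where "j = i + of_nat (Suc k)"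
  obtain g where g: "(f, g) \<in> transfer_upto adler lam i k" "(g, f') \<in> yb_at adler lam i j"
    using Suc.prems(3) by (auto simp: j_def)
  have IH: "\<exists>y. (x, y) \<in> transfer_upto refactor lam i k"
    "\<And>y. (x, y) \<in> transfer_upto refactor lam i k \<Longrightarrow> linked (factor_at i k) y g"
    using Suc.IH[OF _ Suc.prems(2) g(1)] Suc.prems(1) by auto
  have next_eq: "i + of_nat k + 1 = j"
    by (simp add: j_def)
  have at: "factor_at i k (i + of_nat k) = i" "factor_at i k (i + of_nat k + 1) = j"
    unfolding next_eq
    using factor_at_eq[OF gen, of k k i] factor_at_eq[OF gen, of k "Suc k" i, folded j_def]
      Suc.prems(1) by simp_all
  have ne: "i \<noteq> j"
    using plus_of_nat_cyclic_neq[OF gen _ Suc.prems(1)] unfolding j_def by blast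
  have "\<exists>x'. (x, x') \<in> transfer_upto refactor lam i (Suc k)"
  proof -
    obtain y where y: "(x, y) \<in> transfer_upto refactor lam i k"
      using IH(1) by blast
    have "snd (y $ i) + fst (y $ j) = g $ i + g $ j"
      using IH(2)[OF y] at unfolding linked_def by metis
    moreover have "g $ i + g $ j \<noteq> 0"
      using g(2) by (simp add: yb_at_adler[OF ne])
    ultimately obtain x' where "(y, x') \<in> yb_at refactor lam i j"
      using refactor_step_exists[OF ne, of y lam] by auto
    with y show ?thesis
      by (auto simp: j_def)
  qed
  moreover have "linked (factor_at i (Suc k)) x' f'"
    if x': "(x, x') \<in> transfer_upto refactor lam i (Suc k)" for x'
  proof -
    obtain y where y: "(x, y) \<in> transfer_upto refactor lam i k" "(y, x') \<in> yb_at refactor lam i j"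
      using x' by (auto simp: j_def)
    show ?thesis
      using linked_step[OF one_plus_one_neq_zero_cyclic[OF gen N] inj_factor_at at
          IH(2)[OF y(1)] g(2) y(2)] by simp
  qed
  ultimately show ?case
    by blast
qed simp

lemma reduced_transfer_refactor:
  fixes lam :: "'n::{finite,comm_ring_1} rvec"
  assumes gen: "surj (of_nat :: nat \<Rightarrow> 'n)" and N: "3 \<le> CARD('n)"
    and f': "(f, f') \<in> transfer adler lam i"
  shows "\<forall>x\<in>chain_class lam f. transfer refactor lam i `` {x} \<noteq> {}"
    and "reduced_rel lam (transfer refactor lam i) `` {chain_class lam f} = {chain_class lam f'}"
proof -
  have image: "(\<exists>x'. (x, x') \<in> transfer refactor lam i) \<and>
      (\<forall>x'. (x, x') \<in> transfer refactor lam i \<longrightarrow> link x' = chain_g f')"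
    if "link x = chain_g f" for x
    using transfer_upto_refactor[OF gen N _ _ f'[unfolded transfer_def], of x] that
    unfolding transfer_def factor_at_full_cycle[OF gen] linked_succ_iff
    by (simp add: link_eq_chain_g_iff_linked)
  then show "\<forall>x\<in>chain_class lam f. transfer refactor lam i `` {x} \<noteq> {}"
    by (auto simp: chain_class_eq_fibre)
  have class_iff: "proj lam x = chain_class lam h \<longleftrightarrow> link x = chain_g h" for x h
    by (simp add: chain_class_eq_proj_diag proj_eq_iff link_diag)
  obtain x' where "(diag f, x') \<in> transfer refactor lam i"
    using image[of "diag f"] by (auto simp: link_diag)
  moreover from this have "proj lam x' = chain_class lam f'"
    using image[of "diag f"] by (simp add: link_diag class_iff)
  ultimately have "(chain_class lam f, chain_class lam f') \<in> reduced_rel lam (transfer refactor lam i)"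
    unfolding reduced_rel_def by (auto simp: chain_class_eq_proj_diag[of lam f])
  moreover have "c = chain_class lam f'"
    if "(chain_class lam f, c) \<in> reduced_rel lam (transfer refactor lam i)" for c
  proof -
    obtain x y where xy: "proj lam x = chain_class lam f" "c = proj lam y"
        "(x, y) \<in> transfer refactor lam i"
      using \<open>(chain_class lam f, c) \<in> _\<close> unfolding reduced_rel_def by auto
    then show ?thesis
      using image[of x] by (simp add: class_iff)
  qed
  ultimately show "reduced_rel lam (transfer refactor lam i) `` {chain_class lam f}
      = {chain_class lam f'}"
    by (intro equalityI subsetI) blast+
qed

section \<open>The dressing chain as a Hamiltonian reduction\<close>

theorem theorem3:
  fixes lam :: "real ^ 'n::{finite,comm_ring_1}"
  assumes index: "surj (of_nat :: nat \<Rightarrow> 'n)"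
    and N_ge_3: "3 \<le> CARD('n)"
    and N_odd: "odd CARD('n)"
  shows
    "(\<forall>t x y. leaf_gauge lam t x y \<longleftrightarrow> y = act t x) \<and>
     (\<forall>(i::'n) F x s. smooth F \<longrightarrow>
        ((\<lambda>s. F (act (axis i s) x)) has_real_derivative
           leaf_bracket F (ham i) (act (axis i s) x)) (at s)) \<and>
     bij_betw (chain_class lam) UNIV (reduced_space lam) \<and>
     (\<forall>\<phi> :: 'n phase set \<Rightarrow> real. smooth (\<phi> \<circ> proj lam) \<longleftrightarrow> smooth (\<phi> \<circ> chain_class lam)) \<and>
     (\<forall>\<phi> \<psi>. smooth (\<phi> \<circ> proj lam) \<longrightarrow> smooth (\<psi> \<circ> proj lam) \<longrightarrow>
        (\<forall>x. leaf_bracket (\<phi> \<circ> proj lam) (\<psi> \<circ> proj lam) x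
               = reduced_bracket lam \<phi> \<psi> (proj lam x)) \<and>
        (\<forall>f. reduced_bracket lam \<phi> \<psi> (chain_class lam f)
               = chain_bracket (\<phi> \<circ> chain_class lam) (\<psi> \<circ> chain_class lam) f)) \<and>
     (\<forall>i. single_valued (transfer adler lam i) \<and>
          open (Domain (transfer adler lam i)) \<and>
          closure (Domain (transfer adler lam i)) = UNIV \<and>
          (\<forall>f f'. (f, f') \<in> transfer adler lam i \<longrightarrow>
             (\<forall>x\<in>chain_class lam f. transfer refactor lam i `` {x} \<noteq> {}) \<and>
             reduced_rel lam (transfer refactor lam i) `` {chain_class lam f}
               = {chain_class lam f'}))"
proof -
  have bij: "bij (chain_g :: 'n rvec \<Rightarrow> 'n rvec)"
    by (rule bij_chain_g[OF index N_odd])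
  show ?thesis
    by (intro conjI allI impI leaf_gauge_iff_act act_has_derivative_bracket
        bij_betw_chain_class[OF bij] smooth_proj_iff_smooth_chain_class[OF bij]
        reduced_bracket_eq[OF bij] single_valued_transfer_adler[OF index]
        open_dense_Domain_transfer_adler[OF index]
        reduced_transfer_refactor[OF index N_ge_3]) assumption+
qed

end
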